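(* Let $\alpha,\beta>-1$ be real, let $n\in\mathbb N=\{0,1,2,\ldots\}$, and let $D^n_i(x;\alpha,\beta)$ be the dual Bernstein polynomials of degree $n$. For every $i=0,1,\ldots,n$ the polynomial $D^n_i(x;\alpha,\beta)$ satisfies the fourth-order differential equation with polynomial coefficients $$\mathbf N^{(\alpha,\beta)}_{ni}\,\mathbf M^{(\alpha,\beta)}_{ni}\,D^n_i(x;\alpha,\beta)=0,$$ where the operator on the left is the composition of the two second-order differential operators $$\mathbf M^{(\alpha,\beta)}_{ni}:=x(x-1)\mathbf D^2+\big((n+\sigma+3)x-i-\beta-2\big)\mathbf D+(n+\sigma+1)\mathbf I,$$ $$\mathbf N^{(\alpha,\beta)}_{ni}:=\mathbf L^{(\alpha+1,\beta+1)}-\lambda_n^{(\alpha+1,\beta+1)}\mathbf I .$$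
   Context: Notation: $\mathbf D:=\frac{\mathrm d}{\mathrm dx}$, $\mathbf I$ is the identity operator, $\sigma:=\alpha+\beta+1$. For parameters $a,b>-1$, $$\mathbf L^{(a,b)}:=x(x-1)\mathbf D^2+\tfrac12\big(a-b+(a+b+2)(2x-1)\big)\mathbf D,\qquad \lambda_k^{(a,b)}:=k(k+a+b+1).$$ Inner product: $\langle f,g\rangle_{\alpha,\beta}:=\int_0^1(1-x)^\alpha x^\beta f(x)g(x)\,\mathrm dx$. Bernstein basis polynomials: $B^n_i(x):=\binom{n}{i}x^i(1-x)^{n-i}$, $i=0,\ldots,n$; they form a basis of the space $\Pi_n$ of polynomials of degree at most $n$. Dual Bernstein polynomials of degree $n$: the polynomials $D^n_0(x;\alpha,\beta),\ldots,D^n_n(x;\alpha,\beta)\in\Pi_n$ determined by $\langle B^n_i,D^n_j(\cdot;\alpha,\beta)\rangle_{\alpha,\beta}=\delta_{ij}$ for $i,j=0,\ldots,n$. *)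

theory Defs
  imports "HOL-Analysis.Analysis"
begin

text \<open>
  The basis polynomials \<open>B\<^sup>n\<^sub>i\<close> are the library functions \<^term>\<open>Bernstein n i\<close>.
  The operators below act on functions \<^typ>\<open>real \<Rightarrow> real\<close> and are meant for smooth arguments,
  since \<^const>\<open>deriv\<close> is unspecified where the derivative does not exist.
\<close>

definition jacobi_inner :: "real \<Rightarrow> real \<Rightarrow> (real \<Rightarrow> real) \<Rightarrow> (real \<Rightarrow> real) \<Rightarrow> real" where
  "jacobi_inner \<alpha> \<beta> f g =
     integral {0..1} (\<lambda>x. (1 - x) powr \<alpha> * x powr \<beta> * f x * g x)"

text \<open>
  The defining conditions of the dual basis decouple, so that each \<open>D\<^sup>n\<^sub>j\<close> is described
  individually; for \<open>\<alpha>, \<beta> > -1\<close> and \<open>j \<le> n\<close> the description is unique.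
\<close>

definition dual_bernstein :: "nat \<Rightarrow> real \<Rightarrow> real \<Rightarrow> nat \<Rightarrow> real poly" where
  "dual_bernstein n \<alpha> \<beta> j =
     (THE d. degree d \<le> n \<and>
        (\<forall>i\<le>n. jacobi_inner \<alpha> \<beta> (Bernstein n i) (poly d) = (if i = j then 1 else 0)))"

definition L_op :: "real \<Rightarrow> real \<Rightarrow> (real \<Rightarrow> real) \<Rightarrow> real \<Rightarrow> real" where
  "L_op a b f = (\<lambda>x. x * (x - 1) * deriv (deriv f) x
      + 1/2 * (a - b + (a + b + 2) * (2 * x - 1)) * deriv f x)"

definition eigval :: "real \<Rightarrow> real \<Rightarrow> nat \<Rightarrow> real" where
  "eigval a b k = real k * (real k + a + b + 1)"

definition M_op :: "real \<Rightarrow> real \<Rightarrow> nat \<Rightarrow> nat \<Rightarrow> (real \<Rightarrow> real) \<Rightarrow> real \<Rightarrow> real" where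
  "M_op \<alpha> \<beta> n i f = (let \<sigma> = \<alpha> + \<beta> + 1 in
     (\<lambda>x. x * (x - 1) * deriv (deriv f) x
       + ((real n + \<sigma> + 3) * x - real i - \<beta> - 2) * deriv f x
       + (real n + \<sigma> + 1) * f x))"

text \<open>The index \<open>i\<close> is kept for uniformity with \<^const>\<open>M_op\<close>; the operator does not depend on it.\<close>

definition N_op :: "real \<Rightarrow> real \<Rightarrow> nat \<Rightarrow> nat \<Rightarrow> (real \<Rightarrow> real) \<Rightarrow> real \<Rightarrow> real" where
  "N_op \<alpha> \<beta> n i f =
     (\<lambda>x. L_op (\<alpha> + 1) (\<beta> + 1) f x - eigval (\<alpha> + 1) (\<beta> + 1) n * f x)"

end

(*
  Let M and N be the two operators and D the dual polynomial with index i.  The weighted adjoint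
  of M sends x^j (1-x)^(n-1-j) to a combination of B_j and B_(j+1) with coefficients proportional
  to j-i and j+1-i, so B_i never occurs and M D is orthogonal to all polynomials of degree < n for
  the weight with parameters \<alpha>+1, \<beta>+1.  The operator N is symmetric for that weight and
  annihilates the coefficient of degree n; hence N M D has degree < n and is orthogonal to every
  polynomial of degree < n, itself included, which forces it to vanish.
*)
theory Submission
  imports Defs
begin

text \<open>Keep products with \<open>x\<close> and \<open>1 - x\<close> factored.\<close>
declare mult_pCons_left [simp del] mult_pCons_right [simp del]

lemma deriv_poly: "deriv (poly p) = poly (pderiv p)"
  for p :: "real poly"
  by (rule ext) (rule DERIV_imp_deriv, rule poly_DERIV)

lemma poly_eqI_infinite:
  fixes p q :: "real poly"
  assumes "\<And>x. x \<in> S \<Longrightarrow> poly p x = poly q x" and "infinite S"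
  shows "p = q"
proof (rule ccontr)
  assume "p \<noteq> q"
  then have "finite {x. poly (p - q) x = 0}"
    by (intro poly_roots_finite) simp
  moreover have "S \<subseteq> {x. poly (p - q) x = 0}"
    using assms(1) by auto
  ultimately show False
    using assms(2) finite_subset by blast
qed

subsection \<open>The Bernstein basis\<close>

text \<open>Binomial factors are left out and the two exponents are independent, so that multiplying
  by x or 1 - x stays inside the family.\<close>

abbreviation bern :: "nat \<Rightarrow> nat \<Rightarrow> real poly" where
  "bern i j \<equiv> [:0, 1:] ^ i * [:1, -1:] ^ j"

lemma degree_bern_le: "degree (bern i j) \<le> i + j"
proof -
  have "degree (bern i j) \<le> degree ([:0, 1::real:] ^ i) + degree ([:1, -1::real:] ^ j)"
    by (rule degree_mult_le)
  also have "\<dots> \<le> i + j"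
    using degree_power_le[of "[:0, 1::real:]" i] degree_power_le[of "[:1, -1::real:]" j] by simp
  finally show ?thesis .
qed

lemma bern_split: "bern i j = bern (Suc i) j + bern i (Suc j)"
  by (simp add: poly_eq_poly_eq_iff[symmetric] fun_eq_iff algebra_simps)

text \<open>Bernstein polynomials span: as x + (1 - x) = 1, \<open>bern_split\<close> passes from
  total exponent k + 1 down to k, and second exponent 0 gives the monomials.\<close>

lemma linear_eq_0_if_bern_eq_0:
  fixes f :: "real poly \<Rightarrow> real"
  assumes add: "\<And>p q. f (p + q) = f p + f q"
    and smult: "\<And>c p. f (smult c p) = c * f p"
    and bern: "\<And>i. i \<le> n \<Longrightarrow> f (bern i (n - i)) = 0"
    and deg: "degree p \<le> n"
  shows "f p = 0"
proof -
  have "f (bern i j) = 0" if "i + j \<le> n" for i j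
    using that
  proof (induction "n - (i + j)" arbitrary: i j)
    case 0
    then show ?case using bern[of i] by (metis add_diff_cancel_left' diff_is_0_eq le_add1 le_antisym)
  next
    case (Suc k)
    then have "f (bern (Suc i) j) = 0" "f (bern i (Suc j)) = 0"
      by (intro Suc.hyps(1); linarith)+
    then show ?case using add[of "bern (Suc i) j" "bern i (Suc j)"] bern_split[of i j] by (simp del: power_Suc)
  qed
  from this[of _ 0] have monom: "f (monom c i) = 0" if "i \<le> n" for c i
    using that smult[of c "monom 1 i"] by (simp add: monom_altdef smult_monom)
  have f0: "f 0 = 0"
    using smult[of 0 0] by simp
  have "f (\<Sum>i\<in>A. monom (coeff p i) i) = (\<Sum>i\<in>A. f (monom (coeff p i) i))" for A
    by (induction A rule: infinite_finite_induct) (simp_all add: add f0)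
  then have "f (\<Sum>i\<le>n. monom (coeff p i) i) = 0"
    using monom by simp
  then show ?thesis
    by (simp only: poly_as_sum_of_monoms'[OF deg])
qed

text \<open>
  The functional reads off the coefficient of \<open>y\<^sup>j\<close> in \<open>(1 + y)\<^sup>n p(y / (1 + y))\<close>, a substitution
  which turns \<open>x\<^sup>i (1 - x)\<^bsup>n-i\<^esup>\<close> into \<open>y\<^sup>i\<close>.
\<close>

lemma bern_coeff_functional:
  obtains f :: "real poly \<Rightarrow> real"
  where "\<And>p q. f (p + q) = f p + f q" "\<And>c p. f (smult c p) = c * f p"
    "\<And>i. i \<le> n \<Longrightarrow> f (bern i (n - i)) = (if i = j then 1 else 0)"
proof
  define h :: "real poly \<Rightarrow> real poly"
    where "h p = (\<Sum>k\<le>n. monom (coeff p k) k * [:1, 1:] ^ (n - k))" for p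
  show "coeff (h (p + q)) j = coeff (h p) j + coeff (h q) j" for p q
    by (simp add: h_def algebra_simps sum.distrib flip: add_monom)
  show "coeff (h (smult c p)) j = c * coeff (h p) j" for c p
  proof -
    have "h (smult c p) = smult c (h p)"
      by (rule poly_eqI) (simp add: h_def coeff_sum sum_distrib_left flip: smult_monom)
    then show ?thesis by simp
  qed
  show "coeff (h (bern i (n - i))) j = (if i = j then 1 else 0)" if "i \<le> n" for i
  proof -
    \<comment> \<open>Taking y > 0 keeps 1 + y nonzero and still supplies infinitely many points for
      comparing polynomials.\<close>
    have poly_h: "poly (h p) y = (1 + y) ^ n * poly p (y / (1 + y))"
      if "degree p \<le> n" and "y > 0" for p y
    proof -
      have "(1 + y) ^ n * (coeff p k * (y / (1 + y)) ^ k) = coeff p k * y ^ k * (1 + y) ^ (n - k)"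
        if "k \<le> n" for k
        using \<open>y > 0\<close> that by (simp add: power_divide power_diff field_simps)
      then have "(\<Sum>k\<le>n. (1 + y) ^ n * (coeff p k * (y / (1 + y)) ^ k))
          = (\<Sum>k\<le>n. coeff p k * y ^ k * (1 + y) ^ (n - k))"
        by (intro sum.cong) auto
      moreover have "poly p z = (\<Sum>k\<le>n. coeff p k * z ^ k)" for z
        using poly_as_sum_of_monoms'[OF \<open>degree p \<le> n\<close>]
        by (metis (no_types, lifting) poly_monom poly_sum sum.cong)
      ultimately show ?thesis
        by (simp add: h_def poly_sum poly_monom sum_distrib_left)
    qed
    have "h (bern i (n - i)) = monom 1 i"
    proof (rule poly_eqI_infinite[where S = "{0<..}"])
      fix y :: real assume "y \<in> {0<..}"
      then have y: "y > 0" by simp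
      have "1 - y / (1 + y) = 1 / (1 + y)"
        using y by (simp add: field_simps)
      then have "poly (h (bern i (n - i))) y = (1 + y) ^ n * (y / (1 + y)) ^ i * (1 / (1 + y)) ^ (n - i)"
        using degree_bern_le[of i "n - i"] that y by (simp add: poly_h)
      also have "\<dots> = y ^ i"
        using y that by (simp add: power_divide power_diff field_simps)
      finally show "poly (h (bern i (n - i))) y = poly (monom 1 i) y"
        by (simp add: poly_monom)
    qed (rule infinite_Ioi)
    then show ?thesis by (simp add: coeff_monom)
  qed
qed

subsection \<open>Integration against the Jacobi weight\<close>

locale jacobi_weight =
  fixes \<alpha> \<beta> :: real
  assumes \<alpha>: "\<alpha> > -1" and \<beta>: "\<beta> > -1"
begin

text \<open>The inner product of p and q is \<open>J (p * q)\<close>; moving an operator across it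
  becomes a polynomial identity under a linear functional.\<close>

definition J :: "real poly \<Rightarrow> real" where
  "J p = integral {0..1} (\<lambda>x. (1 - x) powr \<alpha> * x powr \<beta> * poly p x)"

text \<open>The weight is a Beta integrand, integrable for \<alpha>, \<beta> > -1, and a polynomial
  is a bounded measurable factor on the unit interval.\<close>

lemma weight_integrable: "(\<lambda>x. (1 - x) powr \<alpha> * x powr \<beta> * poly p x) integrable_on {0..1}"
proof -
  have "(\<lambda>t. t powr \<beta> * (1 - t) powr \<alpha>) integrable_on {0..1}"
    using integrable_Beta'[of "\<beta> + 1" "\<alpha> + 1"] \<alpha> \<beta> by simp
  then have "(\<lambda>t. t powr \<beta> * (1 - t) powr \<alpha>) absolutely_integrable_on {0..1}"
    by (rule nonnegative_absolutely_integrable_1) simp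
  moreover have "continuous_on {0..1} (poly p)"
    by (intro continuous_intros)
  then have "poly p \<in> borel_measurable (lebesgue_on {0..1})" "bounded (poly p ` {0..1})"
    by (auto intro: continuous_imp_measurable_on_sets_lebesgue compact_imp_bounded
        compact_continuous_image)
  ultimately have "(\<lambda>x. poly p x * (x powr \<beta> * (1 - x) powr \<alpha>)) absolutely_integrable_on {0..1}"
    by (subst absolutely_integrable_bounded_measurable_product_real) auto
  then show ?thesis
    by (simp add: mult_ac absolutely_integrable_on_def)
qed

lemma J_add: "J (p + q) = J p + J q"
  unfolding J_def by (simp add: distrib_left integral_add weight_integrable)

lemma J_smult: "J (smult c p) = c * J p"
proof -
  have "J (smult c p) = integral {0..1} (\<lambda>x. c * ((1 - x) powr \<alpha> * x powr \<beta> * poly p x))"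
    unfolding J_def by (simp add: mult_ac)
  then show ?thesis by (simp add: J_def)
qed

lemma J_diff: "J (p - q) = J p - J q"
  using J_add[of p "smult (-1) q"] J_smult[of "-1" q] by simp

text \<open>On [1/4, 3/4] the weight is continuous and positive, so a zero integral makes p vanish
  there, hence at infinitely many points.\<close>

lemma J_pos_definite:
  assumes nonneg: "\<And>x. x \<in> {0..1} \<Longrightarrow> poly p x \<ge> 0" and "J p = 0"
  shows "p = 0"
proof -
  let ?w = "\<lambda>x. (1 - x) powr \<alpha> * x powr \<beta> * poly p x"
  let ?S = "{1/4..3/4::real}"
  have cont: "continuous_on ?S ?w"
    by (intro continuous_intros) auto
  then have int: "?w integrable_on ?S"
    by (rule integrable_continuous_interval)
  have "integral ?S ?w \<le> integral {0..1} ?w"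
    using int nonneg by (intro integral_subset_le weight_integrable) auto
  moreover have "integral ?S ?w \<ge> 0"
    using int nonneg by (intro integral_nonneg) auto
  ultimately have "integral ?S ?w = 0"
    using \<open>J p = 0\<close> by (simp add: J_def)
  then have "(?w has_integral 0) (cbox (1/4) (3/4))"
    using int by (simp add: has_integral_iff)
  then have "?w x = 0" if "x \<in> ?S" for x
    using that nonneg cont by (intro has_integral_0_cbox_imp_0[of "1/4" "3/4" ?w]) auto
  then have "poly p x = poly 0 x" if "x \<in> ?S" for x
    using that by force
  then show ?thesis
    by (rule poly_eqI_infinite[where S = ?S]) (simp_all add: infinite_Icc)
qed

text \<open>The integrand is the derivative of (1-x)^(\<alpha>+1) x^(\<beta>+1) p, which vanishes at
  0 and 1 because both exponents are positive.\<close>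

lemma J_by_parts:
  "J (smult (\<beta> + 1) ([:1, -1:] * p) - smult (\<alpha> + 1) ([:0, 1:] * p)
     + [:0, 1:] * [:1, -1:] * pderiv p) = 0"
  (is "J ?q = 0")
proof -
  let ?F = "\<lambda>x. (1 - x) powr (\<alpha> + 1) * x powr (\<beta> + 1) * poly p x"
  have "((\<lambda>x. (1 - x) powr \<alpha> * x powr \<beta> * poly ?q x) has_integral ?F 1 - ?F 0) {0..1}"
  proof (rule fundamental_theorem_of_calculus_interior)
    show "continuous_on {0..1} ?F"
      using \<alpha> \<beta> by (intro continuous_intros continuous_on_powr') auto
  next
    fix x :: real assume x: "x \<in> {0<..<1}"
    have powr_Suc: "y powr (a + 1) = y * y powr a" if "y > 0" for y a :: real
      using that by (simp add: powr_add)
    have 1: "((\<lambda>x. (1 - x) powr (\<alpha> + 1)) has_real_derivative - (\<alpha> + 1) * (1 - x) powr \<alpha>) (at x)"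
      using x by (auto intro!: derivative_eq_intros simp: powr_Suc algebra_simps)
    have 2: "((\<lambda>x. x powr (\<beta> + 1)) has_real_derivative (\<beta> + 1) * x powr \<beta>) (at x)"
      using x by (auto intro!: derivative_eq_intros simp: powr_Suc)
    show "(?F has_vector_derivative (1 - x) powr \<alpha> * x powr \<beta> * poly ?q x) (at x)"
      unfolding has_real_derivative_iff_has_vector_derivative[symmetric]
      by (rule DERIV_cong[OF DERIV_mult[OF DERIV_mult[OF 1 2] poly_DERIV]])
        (use powr_Suc[of x \<beta>] powr_Suc[of "1 - x" \<alpha>] x in \<open>simp only: greaterThanLessThan_iff diff_gt_0_iff_gt, simp add: algebra_simps\<close>)
  qed simp
  then show ?thesis
    by (simp add: J_def has_integral_iff)
qed

text \<open>Gram-Schmidt, one degree at a time; this supplies the dual polynomials.\<close>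

lemma riesz_poly:
  fixes f :: "real poly \<Rightarrow> real"
  assumes add: "\<And>p q. f (p + q) = f p + f q"
    and smult: "\<And>c p. f (smult c p) = c * f p"
  shows "\<exists>d. degree d \<le> n \<and> (\<forall>p. degree p \<le> n \<longrightarrow> J (p * d) = f p)"
proof -
  text \<open>Induction on a strict degree bound, so that the base case is the zero space.\<close>
  have "\<exists>d. (\<forall>k\<ge>m. coeff d k = 0) \<and> (\<forall>p. (\<forall>k\<ge>m. coeff p k = 0) \<longrightarrow> J (p * d) = f p)"
    if "\<And>p q. f (p + q) = f p + f q" "\<And>c p. f (smult c p) = c * f p"
    for m and f :: "real poly \<Rightarrow> real"
    using that
  proof (induction m arbitrary: f)
    case 0
    then show ?case
      using J_smult[of 0 0] "0.prems"(2)[of 0 0]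
      by (intro exI[of _ 0]) (auto simp flip: poly_eq_iff[where q = 0, simplified])
  next
    case (Suc m)
    note add = Suc.prems(1) and smult = Suc.prems(2)
    obtain d where d: "\<And>k. k \<ge> m \<Longrightarrow> coeff d k = 0"
        "\<And>p. (\<And>k. k \<ge> m \<Longrightarrow> coeff p k = 0) \<Longrightarrow> J (p * d) = f p"
      using Suc.IH[OF add smult] by blast
    \<comment> \<open>The induction hypothesis, now for a second functional, gives the projection e
      of x^m onto lower degrees; u is then the monic orthogonal polynomial of degree m.\<close>
    obtain e where e: "\<And>k. k \<ge> m \<Longrightarrow> coeff e k = 0"
        "\<And>p. (\<And>k. k \<ge> m \<Longrightarrow> coeff p k = 0) \<Longrightarrow> J (p * e) = J (p * monom 1 m)"
      using Suc.IH[of "\<lambda>p. J (p * monom 1 m)"] by (auto simp: algebra_simps J_add J_smult)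
    define u where "u = monom 1 m - e"
    have u_orth: "J (p * u) = 0" if "\<And>k. k \<ge> m \<Longrightarrow> coeff p k = 0" for p
      using e(2)[of p] that by (simp add: u_def algebra_simps J_diff)
    have "coeff u m = 1"
      using e(1) by (simp add: u_def)
    then have "u \<noteq> 0" by auto
    have "J (u * u) \<noteq> 0"
      using J_pos_definite[of "u * u"] \<open>u \<noteq> 0\<close> by auto
    moreover have "J (u * u) = J (monom 1 m * u)"
      using u_orth[OF e(1)] by (simp add: u_def left_diff_distrib J_diff)
    ultimately have uu: "J (monom 1 m * u) \<noteq> 0" by simp
    \<comment> \<open>Chosen to match f at x^m; adding a multiple of u leaves the values at lower
      degrees unchanged.\<close>
    define c where "c = (f (monom 1 m) - J (monom 1 m * d)) / J (monom 1 m * u)"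
    have "J (p * (d + smult c u)) = f p" if p: "\<And>k. k \<ge> Suc m \<Longrightarrow> coeff p k = 0" for p
    proof -
      define q where "q = p - smult (coeff p m) (monom 1 m)"
      have p_eq: "p = q + smult (coeff p m) (monom 1 m)"
        by (simp add: q_def)
      have q: "coeff q k = 0" if "k \<ge> m" for k
        using that p[of k] by (cases "k = m") (auto simp: q_def)
      have "J (q * (d + smult c u)) = f q"
        using d(2)[OF q] u_orth[OF q] by (simp add: distrib_left J_add J_smult)
      moreover have "J (monom 1 m * (d + smult c u)) = f (monom 1 m)"
        using uu by (simp add: distrib_left J_add J_smult c_def)
      ultimately show ?thesis
        by (subst (1 2) p_eq)
          (simp only: distrib_right J_add add mult_smult_left J_smult smult)
    qed
    moreover have "coeff (d + smult c u) k = 0" if "k \<ge> Suc m" for k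
      using that d(1) e(1) by (simp add: u_def)
    ultimately show ?case by blast
  qed
  from this[of f "Suc n", OF assms] obtain d where d: "\<And>k. k \<ge> Suc n \<Longrightarrow> coeff d k = 0"
      "\<And>p. (\<And>k. k \<ge> Suc n \<Longrightarrow> coeff p k = 0) \<Longrightarrow> J (p * d) = f p"
    by blast
  have "degree d \<le> n"
    using d(1) by (intro degree_le) auto
  moreover have "J (p * d) = f p" if "degree p \<le> n" for p
    using that by (intro d(2) coeff_eq_0) auto
  ultimately show ?thesis by blast
qed


text \<open>For b = \<open>bern j k\<close>, x(1-x) b' = (j(1-x) - kx) b, so the factor b in
  \<open>J_by_parts\<close> just shifts \<beta> by j and \<alpha> by k.\<close>

lemma J_by_parts_bern:
  "J (bern j k * (smult (\<beta> + 1 + j) ([:1, -1:] * u) - smult (\<alpha> + 1 + k) ([:0, 1:] * u)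
     + [:0, 1:] * [:1, -1:] * pderiv u)) = 0"
  (is "J ?q = 0")
proof -
  \<comment> \<open>The extra factor p keeps the exponent m in place of m - 1, so m = 0 is covered
    too.\<close>
  have p: "p * pderiv (p ^ m) = smult (real m) (p ^ m * pderiv p)" for p :: "real poly" and m
    by (cases m) (simp_all add: pderiv_power_Suc mult_ac del: power_Suc, simp add: mult_ac)
  have X: "x * poly (pderiv ([:0, 1:] ^ j)) x = j * x ^ j" for x :: real
    using arg_cong[OF p[of "[:0, 1:]" j], of "\<lambda>p. poly p x"] by (simp add: pderiv_pCons)
  have Y: "(1 - x) * poly (pderiv ([:1, -1:] ^ k)) x = - k * (1 - x) ^ k" for x :: real
    using arg_cong[OF p[of "[:1, -1:]" k], of "\<lambda>p. poly p x"] by (simp add: pderiv_pCons)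
  have B: "x * ((1 - x) * poly (pderiv (bern j k)) x)
      = (real j * (1 - x) - real k * x) * poly (bern j k) x" for x
  proof -
    have "x * ((1 - x) * poly (pderiv (bern j k)) x)
        = x * x ^ j * ((1 - x) * poly (pderiv ([:1, -1:] ^ k)) x)
          + (1 - x) * (1 - x) ^ k * (x * poly (pderiv ([:0, 1:] ^ j)) x)"
      by (simp add: pderiv_mult algebra_simps)
    then show ?thesis
      unfolding X Y by (simp add: algebra_simps)
  qed
  define b where "b = bern j k"
  have "smult (\<beta> + 1) ([:1, -1:] * (b * u)) - smult (\<alpha> + 1) ([:0, 1:] * (b * u))
      + [:0, 1:] * [:1, -1:] * pderiv (b * u)
    = b * (smult (\<beta> + 1 + j) ([:1, -1:] * u) - smult (\<alpha> + 1 + k) ([:0, 1:] * u)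
      + [:0, 1:] * [:1, -1:] * pderiv u)" (is "?p = ?q")
  proof -
    have "poly ?p x = poly ?q x + poly u x * (x * ((1 - x) * poly (pderiv b) x)
        - (real j * (1 - x) - real k * x) * poly b x)" for x
      by (simp add: pderiv_mult algebra_simps)
    then show ?thesis
      unfolding b_def B by (simp only: poly_eq_poly_eq_iff[symmetric] fun_eq_iff) simp
  qed
  then show ?thesis
    using J_by_parts[of "b * u"] by (simp only: b_def)
qed

end

subsection \<open>Hypergeometric operators on polynomials\<close>

definition hyp_op :: "real \<Rightarrow> real \<Rightarrow> real \<Rightarrow> real poly \<Rightarrow> real poly" where
  "hyp_op u v w p = [:0, -1, 1:] * pderiv (pderiv p) + [:u, v:] * pderiv p + smult w p"

lemma poly_hyp_op:
  "poly (hyp_op u v w p) x = x * (x - 1) * poly (pderiv (pderiv p)) x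
     + (u + v * x) * poly (pderiv p) x + w * poly p x"
  by (simp add: hyp_op_def algebra_simps)

text \<open>The operator is triangular on monomials: degrees never rise, and the factor of
  \<open>coeff p k\<close> is its eigenvalue at degree k.\<close>

lemma coeff_hyp_op:
  "coeff (hyp_op u v w p) k = (k * (real k - 1) + v * k + w) * coeff p k
     + (k + 1) * (u - k) * coeff p (k + 1)"
  by (cases k; cases "k - 1")
    (simp_all add: hyp_op_def mult_pCons_left mult_pCons_right coeff_pCons coeff_pderiv algebra_simps)

lemma degree_hyp_op_le: "degree (hyp_op u v w p) \<le> degree p"
  by (rule degree_le) (simp add: coeff_hyp_op coeff_eq_0)

lemma M_op_poly:
  "M_op \<alpha> \<beta> n i (poly p)
     = poly (hyp_op (- real i - \<beta> - 2) (n + \<alpha> + \<beta> + 4) (n + \<alpha> + \<beta> + 2) p)"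
  by (simp add: M_op_def deriv_poly poly_hyp_op fun_eq_iff algebra_simps)

lemma N_op_poly:
  "N_op \<alpha> \<beta> n i (poly p)
     = poly (hyp_op (- \<beta> - 2) (\<alpha> + \<beta> + 4) (- eigval (\<alpha> + 1) (\<beta> + 1) n) p)"
  by (simp add: N_op_def L_op_def deriv_poly poly_hyp_op fun_eq_iff field_simps)

section \<open>Adjoint and symmetry of the operators\<close>

context jacobi_weight
begin

text \<open>The instance \<open>r = i\<close>, \<open>j + k = n - 1\<close> is the adjoint of the operator \<open>M\<close>.\<close>

lemma J_hyp_op_bern:
  "J ([:0, 1:] * [:1, -1:] * hyp_op (- r - \<beta> - 2) (real j + real k + \<alpha> + \<beta> + 5) (real j + real k + \<alpha> + \<beta> + 3) d
       * bern j k)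
   = (\<alpha> + 1 + k) * (real j + 1 - r) * J (d * bern (Suc j) k)
     - (\<beta> + 1 + j) * (j - r) * J (d * bern j (Suc k))"
proof -
  \<comment> \<open>Found by matching: the \<open>pderiv d\<close> term yields the second-order
    part, the linear factor the first-order part; the rest involves only d and is split over x and 1
    - x.\<close>
  define u where "u = [:j - r, 1:] * d - [:0, 1:] * [:1, -1:] * pderiv d"
  have "[:0, 1:] * [:1, -1:] * hyp_op (- r - \<beta> - 2) (real j + real k + \<alpha> + \<beta> + 5) (real j + real k + \<alpha> + \<beta> + 3) d
       * bern j k
     = bern j k * (smult (\<beta> + 1 + j) ([:1, -1:] * u) - smult (\<alpha> + 1 + k) ([:0, 1:] * u)
         + [:0, 1:] * [:1, -1:] * pderiv u)
       + (smult ((\<alpha> + 1 + k) * (real j + 1 - r)) (d * bern (Suc j) k)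
         - smult ((\<beta> + 1 + j) * (j - r)) (d * bern j (Suc k)))"
    by (simp add: u_def hyp_op_def pderiv_mult pderiv_diff pderiv_pCons
        poly_eq_poly_eq_iff[symmetric] fun_eq_iff) (simp add: algebra_simps)
  then show ?thesis
    by (simp only: J_add J_diff J_smult J_by_parts_bern)
qed

text \<open>Lagrange's identity: for the weight with parameters \<alpha>+1, \<beta>+1 the weighted
  difference of both sides is the derivative of x^(\<beta>+2) (1-x)^(\<alpha>+2) times the Wronskian
  u.\<close>

lemma J_hyp_op_symmetric:
  "J ([:0, 1:] * [:1, -1:] * hyp_op (- \<beta> - 2) (\<alpha> + \<beta> + 4) w p * q)
   = J ([:0, 1:] * [:1, -1:] * p * hyp_op (- \<beta> - 2) (\<alpha> + \<beta> + 4) w q)"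
proof -
  let ?c = "[:0, 1:] * [:1, -1:] :: real poly"
  define u where "u = p * pderiv q - q * pderiv p"
  have "?c * hyp_op (- \<beta> - 2) (\<alpha> + \<beta> + 4) w p * q - ?c * p * hyp_op (- \<beta> - 2) (\<alpha> + \<beta> + 4) w q
     = bern 1 1 * (smult (\<beta> + 1 + 1) ([:1, -1:] * u) - smult (\<alpha> + 1 + 1) ([:0, 1:] * u)
         + [:0, 1:] * [:1, -1:] * pderiv u)"
    by (simp add: u_def hyp_op_def pderiv_mult pderiv_diff
        poly_eq_poly_eq_iff[symmetric] fun_eq_iff) (simp add: algebra_simps)
  then have "J (?c * hyp_op (- \<beta> - 2) (\<alpha> + \<beta> + 4) w p * q)
      - J (?c * p * hyp_op (- \<beta> - 2) (\<alpha> + \<beta> + 4) w q) = 0"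
    using J_by_parts_bern[of 1 1 u] by (simp only: of_nat_1 J_diff[symmetric])
  then show ?thesis by simp
qed

section \<open>The dual Bernstein polynomials\<close>

lemma jacobi_inner_Bernstein:
  "jacobi_inner \<alpha> \<beta> (Bernstein n i) (poly d) = (n choose i) * J (bern i (n - i) * d)"
proof -
  have "jacobi_inner \<alpha> \<beta> (Bernstein n i) (poly d) = J (smult (n choose i) (bern i (n - i) * d))"
    by (simp add: jacobi_inner_def J_def Bernstein_def mult_ac)
  then show ?thesis by (simp only: J_smult)
qed

text \<open>Justifies the \<open>THE\<close>: \<open>riesz_poly\<close> represents the coefficient
  functional, and the difference of two candidates is orthogonal to the basis, hence to
  itself.\<close>

lemma dual_bernstein:
  assumes "j \<le> n"
  shows "degree (dual_bernstein n \<alpha> \<beta> j) \<le> n"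
    and "i \<le> n \<Longrightarrow> i \<noteq> j \<Longrightarrow> J (dual_bernstein n \<alpha> \<beta> j * bern i (n - i)) = 0"
proof -
  let ?P = "\<lambda>d. degree d \<le> n \<and>
    (\<forall>i\<le>n. jacobi_inner \<alpha> \<beta> (Bernstein n i) (poly d) = (if i = j then 1 else 0))"
  obtain f :: "real poly \<Rightarrow> real"
    where f: "\<And>p q. f (p + q) = f p + f q" "\<And>c p. f (smult c p) = c * f p"
      "\<And>i. i \<le> n \<Longrightarrow> f (bern i (n - i)) = (if i = j then 1 else 0)"
    using bern_coeff_functional[of n j] by blast
  obtain d where d: "degree d \<le> n" "\<And>p. degree p \<le> n \<Longrightarrow> J (p * d) = f p"
    using riesz_poly[of f n] f(1,2) by blast
  \<comment> \<open>The scaling cancels the binomial factor of \<open>Bernstein n j\<close>, absent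
    from \<open>bern\<close>.\<close>
  have "?P (smult (1 / (n choose j)) d)"
  proof (intro conjI allI impI)
    show "jacobi_inner \<alpha> \<beta> (Bernstein n i) (poly (smult (1 / (n choose j)) d))
        = (if i = j then 1 else 0)" if "i \<le> n" for i
      using that degree_bern_le[of i "n - i"] assms
      by (simp add: jacobi_inner_Bernstein d(2) f(3) J_smult)
  qed (use d(1) in auto)
  moreover have "d1 = d2" if "?P d1" "?P d2" for d1 d2
  proof -
    let ?e = "d1 - d2"
    have "J (?e * ?e) = 0"
    proof (rule linear_eq_0_if_bern_eq_0[where f = "\<lambda>p. J (p * ?e)"])
      show "J (bern i (n - i) * ?e) = 0" if "i \<le> n" for i
      proof -
        have "(n choose i) * J (bern i (n - i) * d1) = (n choose i) * J (bern i (n - i) * d2)"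
          using \<open>?P d1\<close> \<open>?P d2\<close> that by (simp flip: jacobi_inner_Bernstein)
        then show ?thesis
          using that by (simp add: right_diff_distrib J_diff)
      qed
      show "degree ?e \<le> n"
        using that by (intro degree_diff_le) auto
    qed (simp_all add: distrib_right J_add J_smult)
    then have "?e * ?e = 0"
      by (intro J_pos_definite) auto
    then show ?thesis by simp
  qed
  ultimately have "\<exists>!d. ?P d" by blast
  then have P: "?P (dual_bernstein n \<alpha> \<beta> j)"
    unfolding dual_bernstein_def by (rule theI')
  then show "degree (dual_bernstein n \<alpha> \<beta> j) \<le> n" by blast
  show "J (dual_bernstein n \<alpha> \<beta> j * bern i (n - i)) = 0" if "i \<le> n" "i \<noteq> j"
  proof -
    have "(n choose i) * J (bern i (n - i) * dual_bernstein n \<alpha> \<beta> j) = 0"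
      using P that by (simp flip: jacobi_inner_Bernstein)
    then show ?thesis
      using that by (simp add: mult.commute)
  qed
qed

end

theorem corollary4p2:
  fixes \<alpha> \<beta> :: real and n i :: nat
  assumes "\<alpha> > -1" and "\<beta> > -1" and "i \<le> n"
  shows "\<forall>x::real. N_op \<alpha> \<beta> n i (M_op \<alpha> \<beta> n i (poly (dual_bernstein n \<alpha> \<beta> i))) x = 0"
proof -
  interpret jacobi_weight \<alpha> \<beta>
    using assms by unfold_locales
  define D where "D = dual_bernstein n \<alpha> \<beta> i"
  define M where "M = hyp_op (- real i - \<beta> - 2) (n + \<alpha> + \<beta> + 4) (n + \<alpha> + \<beta> + 2) D"
  let ?N = "hyp_op (- \<beta> - 2) (\<alpha> + \<beta> + 4) (- eigval (\<alpha> + 1) (\<beta> + 1) n)"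
  let ?c = "[:0, 1:] * [:1, -1:] :: real poly"
  have "degree M \<le> n"
    unfolding M_def D_def by (rule le_trans[OF degree_hyp_op_le dual_bernstein(1)[OF assms(3)]])
  \<comment> \<open>At k = n the diagonal factor n(n-1) + (\<alpha>+\<beta>+4)n -
    n(n+\<alpha>+\<beta>+3) is zero.\<close>
  then have coeff_N: "coeff (?N p) k = 0" if "degree p \<le> n" "k \<ge> n" for p k
    using that by (cases "k = n") (simp_all add: coeff_hyp_op coeff_eq_0 eigval_def algebra_simps)
  have "?N M = 0"
  \<comment> \<open>For n = 0 all coefficients of N M are already zero; otherwise degree below n is
    written as degree at most m.\<close>
  proof (cases n)
    case 0
    then show ?thesis
      using coeff_N \<open>degree M \<le> n\<close> by (simp add: poly_eq_iff)
  next
    case (Suc m)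
    have low_degree: "degree (?N p) \<le> m" if "degree p \<le> n" for p
      using that coeff_N Suc by (intro degree_le) auto
    have M_orth: "J (p * (?c * M)) = 0" if "degree p \<le> m" for p
    proof (rule linear_eq_0_if_bern_eq_0[where f = "\<lambda>p. J (p * (?c * M))"])
      show "J (bern j (m - j) * (?c * M)) = 0" if "j \<le> m" for j
      proof -
        have "j \<noteq> i \<Longrightarrow> J (D * bern j (Suc (m - j))) = 0"
          "Suc j \<noteq> i \<Longrightarrow> J (D * bern (Suc j) (m - j)) = 0"
          using dual_bernstein(2)[OF assms(3), of j] dual_bernstein(2)[OF assms(3), of "Suc j"]
            that Suc by (auto simp: D_def Suc_diff_le)
        \<comment> \<open>At the one index where D is not known to be orthogonal, the linear factor
          vanishes instead.\<close>
        then have orth: "(real j + 1 - real i) * J (D * bern (Suc j) (m - j)) = 0"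
          "(real j - real i) * J (D * bern j (Suc (m - j))) = 0"
          by (cases "Suc j = i", auto)+
        \<comment> \<open>Here j + (m - j) = n - 1, which accounts for 5 and 3 in place of 4 and
          2.\<close>
        have M_eq: "hyp_op (- real i - \<beta> - 2) (real j + real (m - j) + \<alpha> + \<beta> + 5)
            (real j + real (m - j) + \<alpha> + \<beta> + 3) D = M"
          using that Suc by (simp add: M_def of_nat_diff add_ac)
        have "J (?c * M * bern j (m - j))
            = (\<alpha> + 1 + real (m - j)) * ((real j + 1 - real i) * J (D * bern (Suc j) (m - j)))
              - (\<beta> + 1 + real j) * ((real j - real i) * J (D * bern j (Suc (m - j))))"
          unfolding M_eq[symmetric] J_hyp_op_bern by (simp only: mult.assoc)
        then have "J (?c * M * bern j (m - j)) = 0"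
          unfolding orth by (simp only: mult_zero_right diff_self)
        then show ?thesis
          by (rule back_subst[where P = "\<lambda>p. J p = 0"]) (rule mult.commute)
      qed
      show "J ((p + q) * (?c * M)) = J (p * (?c * M)) + J (q * (?c * M))" for p q
        by (simp only: distrib_right J_add)
      show "J (smult c p * (?c * M)) = c * J (p * (?c * M))" for c p
        by (simp only: mult_smult_left J_smult)
    qed (rule that)
    \<comment> \<open>N(N M) serves as test polynomial against M; symmetry then moves one N across
      and leaves the square of N M.\<close>
    have deg: "degree (?N (?N M)) \<le> m"
      by (rule le_trans[OF degree_hyp_op_le low_degree[OF \<open>degree M \<le> n\<close>]])
    have "J (?N (?N M) * (?c * M)) = 0"
      by (rule M_orth[OF deg])
    then have "J (?c * M * ?N (?N M)) = 0"
      by (rule back_subst[where P = "\<lambda>p. J p = 0"]) (rule mult.commute)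
    then have orth: "J (?c * ?N M * ?N M) = 0"
      by (rule trans[OF J_hyp_op_symmetric])
    have "?c * ?N M * ?N M = 0"
    proof (rule J_pos_definite[OF _ orth])
      fix x :: real assume "x \<in> {0..1}"
      moreover have "poly (?c * ?N M * ?N M) x = x * (1 - x) * (poly (?N M) x * poly (?N M) x)"
        by simp
      ultimately show "poly (?c * ?N M * ?N M) x \<ge> 0"
        by (simp only:) simp
    qed
    then show ?thesis by auto
  qed
  then show ?thesis
    unfolding D_def[symmetric] M_op_poly M_def[symmetric] N_op_poly by simp
qed

end
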